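(* Let $k\ge 1$ be an integer, let $a,b,A_0,A_1\in\mathbb{R}$ with $b\neq 0$, and write $a\pm ib=re^{\pm i\theta}$ with $r>0$ and $\theta\in\mathbb{R}$. Let $$g[n]=\mathcal{Z}^{-1}\left(\frac{A_1z+A_0}{\left(z^2-2az+(a^2+b^2)\right)^k}\right)$$ be the inverse unilateral $\mathcal{Z}$-transform. Define $$f_0[n]=\frac{2\,(-1)^{k-1}r^{n-2k}}{(2\sin\theta)^{2k-1}}\sum_{j=0}^{k-1}(-1)^j\binom{n-1}{j}\binom{n-(k+1+j)}{k-1-j}\sin\left((n-2j-1)\theta\right),\qquad f_1[n]=f_0[n+1].$$ Then for every integer $n\ge 0$, $$g[n]=A_1f_1[n]+A_0f_0[n]=A_1f_0[n+1]+A_0f_0[n].$$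
   Context: Unilateral $\mathcal{Z}$-transform: for a sequence $x[n]$, $n=0,1,2,\dots$, $X(z)=\mathcal{Z}(x)(z)=\sum_{n=0}^{\infty}x[n]z^{-n}$, for $|z|$ sufficiently large. The inverse $\mathcal{Z}^{-1}(X)$ of a rational function $X$ (with numerator degree at most the denominator degree) is the unique sequence $(x[n])_{n\ge 0}$ whose transform equals $X(z)$ for all $|z|$ sufficiently large. Binomial convention: for integers $\nu$ and $\kappa\ge 0$, $\binom{\nu}{\kappa}=\frac{\nu(\nu-1)\cdots(\nu-\kappa+1)}{\kappa!}$ if $\kappa\le\nu$, and $\binom{\nu}{\kappa}=0$ whenever $\kappa>\nu$ (in particular $\binom{\nu}{\kappa}=0$ for all $\nu<0$, $\kappa\ge 0$). *)

theory Defs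
  imports "HOL-Complex_Analysis.Complex_Analysis"
begin

text \<open>The filter \<^const>\<open>at_infinity\<close> expresses "for all \<open>z\<close> with \<open>|z|\<close> sufficiently large";
  \<^const>\<open>sums\<close> includes the convergence of the series.\<close>

definition has_ztransform :: "(nat \<Rightarrow> complex) \<Rightarrow> (complex \<Rightarrow> complex) \<Rightarrow> bool"
  where "has_ztransform x X \<longleftrightarrow>
    (\<forall>\<^sub>F z in at_infinity. (\<lambda>n. x n * z powi (- int n)) sums X z)"

definition inv_ztransform :: "(complex \<Rightarrow> complex) \<Rightarrow> nat \<Rightarrow> complex"
  where "inv_ztransform X = (THE x. has_ztransform x X)"

text \<open>This differs from \<^const>\<open>gbinomial\<close>, which does not vanish for negative upper argument.\<close>

definition binom :: "int \<Rightarrow> nat \<Rightarrow> real"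
  where "binom \<nu> \<kappa> = (if int \<kappa> \<le> \<nu> then of_int \<nu> gchoose \<kappa> else 0)"

lemma has_ztransform_unique:
  assumes "has_ztransform x X" and "has_ztransform y X"
  shows "x = y"
proof -
  have "\<forall>\<^sub>F z in at_infinity. (\<lambda>n. x n * z powi (- int n)) sums X z \<and>
      (\<lambda>n. y n * z powi (- int n)) sums X z"
    using assms unfolding has_ztransform_def by (rule eventually_conj)
  then obtain B where B: "\<And>z. norm z \<ge> B \<Longrightarrow>
      (\<lambda>n. x n * z powi (- int n)) sums X z \<and> (\<lambda>n. y n * z powi (- int n)) sums X z"
    unfolding eventually_at_infinity by blast
  define e where "e = 1 / max 1 B"
  have e: "e > 0" by (simp add: e_def)
  have d: "(\<lambda>n. (x n - y n) * w ^ n) sums 0" if w: "w \<noteq> 0" "norm w < e" for w :: complex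
  proof -
    have "max 1 B * norm w < 1" using w(2) by (simp add: e_def pos_less_divide_eq mult.commute)
    then have "max 1 B \<le> 1 / norm w"
      using w(1) by (simp add: pos_le_divide_eq less_imp_le del: max.bounded_iff)
    then have "max 1 B \<le> norm (inverse w)" by (simp add: norm_inverse inverse_eq_divide norm_divide)
    then have "norm (inverse w) \<ge> B" by simp
    from B[OF this] have "(\<lambda>n. x n * w ^ n) sums X (inverse w)" "(\<lambda>n. y n * w ^ n) sums X (inverse w)"
      by (simp_all add: power_int_minus power_inverse)
    from sums_diff[OF this] show ?thesis by (simp add: algebra_simps)
  qed
  have s: "(\<lambda>n. (x n - y n) * w ^ n) sums
      (if w = 0 then x 0 - y 0 else 0)" if "norm w < e" for w :: complex
    using d[of w] that powser_sums_zero[of "\<lambda>n. x n - y n"] by auto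
  have "((\<lambda>w::complex. if w = 0 then x 0 - y 0 else 0) \<longlongrightarrow> x 0 - y 0) (at 0)"
    by (rule powser_limit_0[OF e, of "\<lambda>n. x n - y n"]) (use s in auto)
  moreover have "((\<lambda>w::complex. if w = 0 then x 0 - y 0 else 0) \<longlongrightarrow> 0) (at 0)"
    by (rule Lim_transform_eventually[OF tendsto_const])
      (auto simp: eventually_at intro!: exI[of _ 1])
  ultimately have z0: "x 0 - y 0 = 0" using tendsto_unique[OF trivial_limit_at] by blast
  have "x n - y n = 0" for n
  proof (rule ccontr)
    assume n: "x n - y n \<noteq> 0"
    with z0 have "n > 0" by (cases n) auto
    have s0: "(\<lambda>n. (x n - y n) * (w - 0) ^ n) sums 0" if "norm (w - 0) < e" for w :: complex
      using s[of w] that z0 by (simp split: if_splits)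
    obtain t where t: "t > 0" "\<And>z::complex. z \<in> cball 0 t - {0} \<Longrightarrow> (0::complex) \<noteq> 0"
      using powser_0_nonzero[OF e s0 refl n \<open>n > 0\<close>] by blast
    show False using t(2)[of "of_real t"] t(1) by simp
  qed
  then show ?thesis by auto
qed

lemma inv_ztransform_eqI:
  assumes "has_ztransform x X"
  shows "inv_ztransform X = x"
  unfolding inv_ztransform_def using assms has_ztransform_unique by blast

end

theory Submission
  imports Defs
begin

text \<open>
  Substituting \<open>w = 1/z\<close> turns the transform into a power series in \<open>w\<close>: since
  \<open>z\<^sup>2 - 2 a z + (a\<^sup>2 + b\<^sup>2) = Q(w) / w\<^sup>2\<close> with
  \<open>Q(w) = 1 - 2 r cos \<theta> w + r\<^sup>2 w\<^sup>2\<close>, the given rational function is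
  \<open>(A\<^sub>1 w\<^bsup>2k-1\<^esup> + A\<^sub>0 w\<^bsup>2k\<^esup>) / Q(w)\<^bsup>k\<^esup>\<close>, and its Taylor coefficients at
  \<open>w = 0\<close> form the inverse transform. Hence everything reduces to showing that
  \<open>f\<^sub>0[m + 2k]\<close> is the \<open>m\<close>-th coefficient of \<open>1 / Q\<^bsup>k\<^esup>\<close>; for \<open>n < 2k\<close> the second binomial
  coefficient in \<open>f\<^sub>0[n]\<close> vanishes in every summand.

  This is proved by induction on \<open>k\<close> through \<open>Q \<cdot> (1 / Q\<^bsup>k+1\<^esup>) = 1 / Q\<^bsup>k\<^esup>\<close>. In terms of
  the sum \<open>S\<^sub>k(N)\<close> of signed products of binomial coefficients and sines, where
  \<open>N = n - 1\<close>, that relation between coefficients reads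
  \[ S_k(N) - 2 \cos\theta\, S_k(N-1) + S_k(N-2) = -4 \sin^2\theta\, S_{k-1}(N-2). \]
  Both \<open>2 cos \<theta>\<close> and \<open>-4 sin\<^sup>2 \<theta>\<close> act on \<open>e \<mapsto> sin (e \<theta>)\<close> as shift operators, so the
  identity follows (\<open>sine_sum_recurrence\<close>) from an identity between the products of binomial
  coefficients, which is nothing but repeated use of Pascal's rule (\<open>coef_recurrence\<close>). To have
  it without side conditions, the binomial coefficients are extended polynomially to negative
  upper arguments. This extension makes \<open>S\<^sub>k(2k-2)\<close> and \<open>S\<^sub>k(2k-3)\<close> meaningful, and both
  vanish for \<open>k \<ge> 2\<close> (\<open>sine_sum_boundary\<close>), which supplies the initial values of the recurrence.
\<close>

section \<open>Binomial coefficients satisfying Pascal's rule everywhere\<close>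

text \<open>The polynomial extension in the upper argument, and zero for negative lower argument:
  with this choice Pascal's rule has no exceptions. It differs from \<^const>\<open>binom\<close> at negative
  upper arguments.\<close>

definition zbinom :: "int \<Rightarrow> int \<Rightarrow> real"
  where "zbinom \<nu> \<kappa> = (if \<kappa> < 0 then 0 else of_int \<nu> gchoose nat \<kappa>)"

lemma zbinom_Pascal: "zbinom \<nu> \<kappa> = zbinom (\<nu> - 1) \<kappa> + zbinom (\<nu> - 1) (\<kappa> - 1)"
proof (cases "\<kappa> \<le> 0")
  case True
  then show ?thesis by (cases "\<kappa> = 0") (auto simp: zbinom_def)
next
  case False
  then have "nat \<kappa> = Suc (nat (\<kappa> - 1))" by simp
  moreover have "(of_int \<nu> :: real) = of_int (\<nu> - 1) + 1" by simp
  ultimately show ?thesis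
    using False by (simp only: zbinom_def gbinomial_Suc_Suc) simp
qed

lemma zbinom_of_nat: "zbinom (int n) (int j) = of_nat (n choose j)"
  by (simp add: zbinom_def binomial_gbinomial)

lemma zbinom_eq_0: "0 \<le> \<nu> \<Longrightarrow> \<nu> < \<kappa> \<Longrightarrow> zbinom \<nu> \<kappa> = 0"
  using zbinom_of_nat[of "nat \<nu>" "nat \<kappa>"] by simp

lemma binom_eq_zbinom: "int j \<le> \<nu> \<Longrightarrow> binom \<nu> j = zbinom \<nu> (int j)"
  by (simp add: binom_def zbinom_def)

section \<open>A recurrence for the alternating sine sum\<close>

definition coef :: "int \<Rightarrow> int \<Rightarrow> int \<Rightarrow> real"
  where "coef k N j = (-1) powi j * zbinom N j * zbinom (N - k - j) (k - 1 - j)"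

definition sine_sum :: "real \<Rightarrow> int \<Rightarrow> int \<Rightarrow> real"
  where "sine_sum \<theta> k N = (\<Sum>j\<in>{0..<k}. coef k N j * sin (of_int (N - 2 * j) * \<theta>))"

lemma coef_eq_0: "j \<notin> {0..<k} \<Longrightarrow> coef k N j = 0"
  by (auto simp: coef_def zbinom_def)

text \<open>
  Expand every coefficient by Pascal's rule down to the upper arguments \<open>N - 2\<close> in the first
  factor and \<open>p = N - k - j - 1\<close> in the second. With \<open>q = k - 1 - j\<close>, both sides become
  \[ \binom{N}{j}\binom{p}{q-1} + 2\binom{N-1}{j-1}\binom{p}{q} + \binom{N-2}{j-2}\binom{p}{q+1} \]
  times \<open>(-1)\<^bsup>j\<^esup>\<close>.
\<close>

lemma coef_recurrence:
  "coef k N j - coef k (N - 1) j - coef k (N - 1) (j - 1) + coef k (N - 2) (j - 1) =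
   coef (k - 1) (N - 2) j - 2 * coef (k - 1) (N - 2) (j - 1) + coef (k - 1) (N - 2) (j - 2)"
proof -
  define p where "p = N - k - j - 1"
  define q where "q = k - 1 - j"
  have sg: "(-1::real) powi (j - 1) = - ((-1) powi j)" "(-1::real) powi (j - 2) = (-1) powi j"
    by (simp_all add: power_int_diff)
  have upper:
    "zbinom N j = zbinom (N - 2) j + 2 * zbinom (N - 2) (j - 1) + zbinom (N - 2) (j - 2)"
    "zbinom (N - 1) j = zbinom (N - 2) j + zbinom (N - 2) (j - 1)"
    "zbinom (N - 1) (j - 1) = zbinom (N - 2) (j - 1) + zbinom (N - 2) (j - 2)"
    using zbinom_Pascal[of N j] zbinom_Pascal[of "N - 1" j] zbinom_Pascal[of "N - 1" "j - 1"]
    by simp_all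
  have lower:
    "zbinom (p + 1) q = zbinom p q + zbinom p (q - 1)"
    "zbinom (p + 1) (q + 1) = zbinom p (q + 1) + zbinom p q"
    "zbinom (p + 2) (q + 1) = zbinom p (q + 1) + 2 * zbinom p q + zbinom p (q - 1)"
    using zbinom_Pascal[of "p + 1" q] zbinom_Pascal[of "p + 1" "q + 1"]
      zbinom_Pascal[of "p + 2" "q + 1"]
    by (simp_all add: add.commute)
  have idx: "N - k - j = p + 1" "k - 1 - j = q" "N - 1 - k - j = p"
    "N - 1 - k - (j - 1) = p + 1" "k - 1 - (j - 1) = q + 1" "N - 2 - k - (j - 1) = p"
    "N - 2 - (k - 1) - j = p" "k - 1 - 1 - j = q - 1"
    "N - 2 - (k - 1) - (j - 1) = p + 1" "k - 1 - 1 - (j - 1) = q"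
    "N - 2 - (k - 1) - (j - 2) = p + 2" "k - 1 - 1 - (j - 2) = q + 1"
    by (simp_all add: p_def q_def)
  show ?thesis
    unfolding coef_def idx sg upper lower by (simp add: algebra_simps)
qed

text \<open>Lets sums against shifted copies of \<open>g\<close> be compared coefficientwise over one
  common range.\<close>

lemma sum_shift_support:
  fixes d g :: "int \<Rightarrow> real"
  assumes "\<And>j. j \<notin> {0..<u} \<Longrightarrow> d j = 0" "i \<ge> 0" "u + i \<le> v"
  shows "(\<Sum>j\<in>{0..<u}. d j * g (j + i)) = (\<Sum>j\<in>{0..<v}. d (j - i) * g j)"
proof -
  have "(\<Sum>j\<in>{0..<u}. d j * g (j + i)) = (\<Sum>j\<in>{i..<u + i}. d (j - i) * g j)"
    by (rule sum.reindex_bij_witness[of _ "\<lambda>j. j - i" "\<lambda>j. j + i"]) auto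
  also have "\<dots> = (\<Sum>j\<in>{0..<v}. d (j - i) * g j)"
    by (rule sum.mono_neutral_left) (use assms in auto)
  finally show ?thesis .
qed

text \<open>
  The relations \<open>2 cos \<theta> sin (e\<theta>) = sin ((e+1)\<theta>) + sin ((e-1)\<theta>)\<close> and
  \<open>-4 sin\<^sup>2 \<theta> sin (e\<theta>) = sin ((e+2)\<theta>) - 2 sin (e\<theta>) + sin ((e-2)\<theta>)\<close> express both sides in
  the sines \<open>g j = sin ((N-2j)\<theta>)\<close>, and the coefficients of each \<open>g j\<close> agree by
  \<open>coef_recurrence\<close>.
\<close>

lemma sine_sum_recurrence:
  "sine_sum \<theta> k N - 2 * cos \<theta> * sine_sum \<theta> k (N - 1) + sine_sum \<theta> k (N - 2) =
   - (4 * (sin \<theta>)\<^sup>2 * sine_sum \<theta> (k - 1) (N - 2))"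
proof -
  define g where "g j = sin (of_int (N - 2 * j) * \<theta>)" for j
  have two_cos: "2 * cos \<theta> * sin (of_int (N - 1 - 2 * j) * \<theta>) = g j + g (j + 1)" for j
  proof -
    have "of_int (N - 2 * j) * \<theta> = of_int (N - 1 - 2 * j) * \<theta> + \<theta>"
      "of_int (N - 2 * (j + 1)) * \<theta> = of_int (N - 1 - 2 * j) * \<theta> - \<theta>"
      by (simp_all add: algebra_simps)
    then show ?thesis unfolding g_def by (simp only: sin_add sin_diff) simp
  qed
  have four_sin: "- (4 * (sin \<theta>)\<^sup>2 * sin (of_int (N - 2 - 2 * j) * \<theta>)) = g j - 2 * g (j + 1) + g (j + 2)" for j
  proof -
    have e: "of_int (N - 2 * j) * \<theta> = of_int (N - 2 - 2 * j) * \<theta> + 2 * \<theta>"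
      "of_int (N - 2 * (j + 2)) * \<theta> = of_int (N - 2 - 2 * j) * \<theta> - 2 * \<theta>"
      "N - 2 * (j + 1) = N - 2 - 2 * j"
      by (simp_all add: algebra_simps)
    show ?thesis unfolding g_def e by (simp only: sin_add sin_diff cos_double_sin) (simp add: algebra_simps)
  qed
  note shift = sum_shift_support[where v = "k + 1" and g = g]
  have 1: "sine_sum \<theta> k N = (\<Sum>j\<in>{0..<k + 1}. coef k N j * g j)"
    using shift[of k "coef k N" 0, OF coef_eq_0] by (simp add: sine_sum_def g_def)
  have "2 * cos \<theta> * sine_sum \<theta> k (N - 1) =
      (\<Sum>j\<in>{0..<k}. coef k (N - 1) j * (2 * cos \<theta> * sin (of_int (N - 1 - 2 * j) * \<theta>)))"
    by (simp add: sine_sum_def sum_distrib_left mult_ac)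
  also have "\<dots> = (\<Sum>j\<in>{0..<k}. coef k (N - 1) j * g (j + 0)) + (\<Sum>j\<in>{0..<k}. coef k (N - 1) j * g (j + 1))"
    by (simp only: two_cos distrib_left sum.distrib add_0_right)
  also have "\<dots> = (\<Sum>j\<in>{0..<k + 1}. (coef k (N - 1) j + coef k (N - 1) (j - 1)) * g j)"
    by (subst (1 2) shift[OF coef_eq_0]) (simp_all add: sum.distrib distrib_right)
  finally have 2: "2 * cos \<theta> * sine_sum \<theta> k (N - 1) = \<dots>" .
  have "sine_sum \<theta> k (N - 2) = (\<Sum>j\<in>{0..<k}. coef k (N - 2) j * g (j + 1))"
    by (simp add: sine_sum_def g_def algebra_simps)
  also have "\<dots> = (\<Sum>j\<in>{0..<k + 1}. coef k (N - 2) (j - 1) * g j)"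
    by (subst shift[OF coef_eq_0]) simp_all
  finally have 3: "sine_sum \<theta> k (N - 2) = \<dots>" .
  have "- (4 * (sin \<theta>)\<^sup>2 * sine_sum \<theta> (k - 1) (N - 2)) =
      (\<Sum>j\<in>{0..<k - 1}. coef (k - 1) (N - 2) j * (- (4 * (sin \<theta>)\<^sup>2 * sin (of_int (N - 2 - 2 * j) * \<theta>))))"
    by (simp add: sine_sum_def sum_distrib_left sum_negf mult_ac)
  also have "\<dots> = (\<Sum>j\<in>{0..<k - 1}. coef (k - 1) (N - 2) j * g (j + 0))
      - 2 * (\<Sum>j\<in>{0..<k - 1}. coef (k - 1) (N - 2) j * g (j + 1))
      + (\<Sum>j\<in>{0..<k - 1}. coef (k - 1) (N - 2) j * g (j + 2))"
    unfolding four_sin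
    by (simp add: sum_distrib_left algebra_simps sum.distrib sum_subtractf)
  also have "\<dots> = (\<Sum>j\<in>{0..<k + 1}. (coef (k - 1) (N - 2) j - 2 * coef (k - 1) (N - 2) (j - 1)
      + coef (k - 1) (N - 2) (j - 2)) * g j)"
    by (subst (1 2 3) shift[OF coef_eq_0])
      (simp_all add: sum_distrib_left algebra_simps sum.distrib sum_subtractf)
  finally have 4: "- (4 * (sin \<theta>)\<^sup>2 * sine_sum \<theta> (k - 1) (N - 2)) = \<dots>" .
  show ?thesis
    unfolding 4 unfolding 1 2 3 sum_subtractf[symmetric] sum.distrib[symmetric]
      coef_recurrence[symmetric]
    by (simp add: algebra_simps)
qed

text \<open>
  Only summands whose second binomial coefficient has a negative upper argument survive. For
  \<open>N = 2k - 2\<close> this is \<open>j = k - 1\<close>, where the sine is \<open>sin 0\<close>. For \<open>N = 2k - 3\<close> these are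
  \<open>j = k - 1\<close> and \<open>j = k - 2\<close>; their coefficients agree by symmetry of the binomial
  coefficients, and their sines are \<open>\<mp> sin \<theta>\<close>, so they cancel.
\<close>

lemma sine_sum_boundary:
  assumes "k \<ge> 2"
  shows "sine_sum \<theta> k (2 * k - 2) = 0" "sine_sum \<theta> k (2 * k - 3) = 0"
proof -
  show "sine_sum \<theta> k (2 * k - 2) = 0"
    unfolding sine_sum_def
  proof (rule sum.neutral, rule ballI)
    fix j assume j: "j \<in> {0..<k}"
    show "coef k (2 * k - 2) j * sin (of_int (2 * k - 2 - 2 * j) * \<theta>) = 0"
    proof (cases "j = k - 1")
      case False
      with j show ?thesis by (simp add: coef_def zbinom_eq_0)
    qed simp
  qed
  have split: "{0..<k} = insert (k - 1) (insert (k - 2) {0..<k - 2})"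
    using assms by auto
  have rest: "coef k (2 * k - 3) j = 0" if "j \<in> {0..<k - 2}" for j
    using that by (simp add: coef_def zbinom_eq_0)
  have sym: "zbinom (2 * k - 3) (k - 1) = zbinom (2 * k - 3) (k - 2)"
  proof -
    have "nat (2 * k - 3) choose nat (k - 1) = nat (2 * k - 3) choose nat (k - 2)"
      using assms by (subst binomial_symmetric) (auto simp: nat_diff_distrib' intro!: arg_cong2[where f = binomial])
    then show ?thesis
      using assms zbinom_of_nat[of "nat (2 * k - 3)" "nat (k - 1)"]
        zbinom_of_nat[of "nat (2 * k - 3)" "nat (k - 2)"] by simp
  qed
  have "coef k (2 * k - 3) (k - 1) = coef k (2 * k - 3) (k - 2)"
    using sym by (simp add: coef_def power_int_diff zbinom_def)
  moreover have "sin (of_int (2 * k - 3 - 2 * (k - 1)) * \<theta>) = - sin (of_int (2 * k - 3 - 2 * (k - 2)) * \<theta>)"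
    by simp
  ultimately show "sine_sum \<theta> k (2 * k - 3) = 0"
    unfolding sine_sum_def split using rest by simp
qed

section \<open>Power series coefficients of the reciprocal of the denominator\<close>

text \<open>The closed form for the coefficients of \<open>1 / Q\<^bsup>k\<^esup>\<close>, with \<open>m = n - 2k\<close>; meaningful for
  \<open>k \<ge> 1\<close>, because the exponents are truncated.\<close>

definition response :: "real \<Rightarrow> real \<Rightarrow> nat \<Rightarrow> nat \<Rightarrow> real"
  where "response r \<theta> k m = 2 * (-1) ^ (k - 1) * r ^ m / (2 * sin \<theta>) ^ (2 * k - 1) *
    sine_sum \<theta> (int k) (int m + 2 * int k - 1)"

text \<open>The reversed denominator \<open>Q(w) = w\<^sup>2 (z\<^sup>2 - 2 a z + r\<^sup>2)\<close> with \<open>w = 1/z\<close> and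
  \<open>a = r cos \<theta>\<close>.\<close>

definition denom_fps :: "real \<Rightarrow> real \<Rightarrow> complex fps"
  where "denom_fps r \<theta> = 1 - fps_const (of_real (2 * r * cos \<theta>)) * fps_X + fps_const (of_real (r\<^sup>2)) * fps_X\<^sup>2"

lemma denom_fps_mult_nth:
  "fps_nth (denom_fps r \<theta> * Abs_fps (\<lambda>m. of_real (h m))) m =
    of_real (h m - 2 * r * cos \<theta> * (if m = 0 then 0 else h (m - 1)) + r\<^sup>2 * (if m < 2 then 0 else h (m - 2)))"
  by (auto simp: denom_fps_def distrib_right left_diff_distrib fps_X_power_mult_nth mult.assoc)

lemma response_one:
  assumes "sin \<theta> \<noteq> 0"
  shows "response r \<theta> 1 m = r ^ m * sin (real (m + 1) * \<theta>) / sin \<theta>"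
proof -
  have "{0..<1::int} = {0}" by auto
  then show ?thesis using assms by (simp add: response_def sine_sum_def coef_def zbinom_def algebra_simps)
qed

text \<open>The base case stands apart from the inductive step since \<^const>\<open>sine_sum\<close> for \<open>k = 1\<close> is a
  single sine, whose value at \<open>N = 2k - 3 = -1\<close> does not vanish: this is where the constant
  term \<open>1\<close> comes from.\<close>

lemma denom_fps_response_one:
  assumes "sin \<theta> \<noteq> 0"
  shows "denom_fps r \<theta> * Abs_fps (\<lambda>m. of_real (response r \<theta> 1 m)) = 1"
proof (rule fps_ext)
  fix m :: nat
  consider "m = 0" | "m = 1" | i where "m = i + 2"
    by (metis One_nat_def add_2_eq_Suc' not0_implies_Suc)
  then show "fps_nth (denom_fps r \<theta> * Abs_fps (\<lambda>m. of_real (response r \<theta> 1 m))) m = fps_nth 1 m"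
    unfolding denom_fps_mult_nth response_one[OF assms]
  proof cases
    case 3
    have "sin (real (m + 1) * \<theta>) - 2 * cos \<theta> * sin (real (i + 2) * \<theta>) + sin (real (i + 1) * \<theta>) = 0"
    proof -
      have "real (m + 1) * \<theta> = real (i + 2) * \<theta> + \<theta>" "real (i + 1) * \<theta> = real (i + 2) * \<theta> - \<theta>"
        using 3 by (simp_all add: algebra_simps)
      then show ?thesis by (simp only: sin_add sin_diff) simp
    qed
    then have "r ^ m / sin \<theta> * (sin (real (m + 1) * \<theta>) - 2 * cos \<theta> * sin (real (i + 2) * \<theta>)
        + sin (real (i + 1) * \<theta>)) = 0"
      by simp
    then have "r ^ m * sin (real (m + 1) * \<theta>) / sin \<theta>
        - 2 * r * cos \<theta> * (if m = 0 then 0 else r ^ (m - 1) * sin (real (m - 1 + 1) * \<theta>) / sin \<theta>)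
        + r\<^sup>2 * (if m < 2 then 0 else r ^ (m - 2) * sin (real (m - 2 + 1) * \<theta>) / sin \<theta>) = 0"
      using 3 assms by (simp add: field_simps power2_eq_square)
    then show "of_real (r ^ m * sin (real (m + 1) * \<theta>) / sin \<theta>
        - 2 * r * cos \<theta> * (if m = 0 then 0 else r ^ (m - 1) * sin (real (m - 1 + 1) * \<theta>) / sin \<theta>)
        + r\<^sup>2 * (if m < 2 then 0 else r ^ (m - 2) * sin (real (m - 2 + 1) * \<theta>) / sin \<theta>))
      = fps_nth (1 :: complex fps) m"
      using 3 by (simp only: of_real_0) simp
  qed (use assms in \<open>simp_all add: sin_double\<close>)
qed

text \<open>
  The sine sum recurrence multiplied by the common prefactor \<open>C\<close>. In the coefficients of
  \<open>w\<^sup>0\<close> and \<open>w\<^sup>1\<close> the product with \<open>Q\<close> has no terms for \<open>m - 1 < 0\<close> or \<open>m - 2 < 0\<close>, whereas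
  the recurrence has; these extra values are the boundary zeros.
\<close>

lemma denom_fps_response_Suc:
  assumes "sin \<theta> \<noteq> 0" and "k \<ge> 1"
  shows "denom_fps r \<theta> * Abs_fps (\<lambda>m. of_real (response r \<theta> (Suc k) m)) =
    Abs_fps (\<lambda>m. of_real (response r \<theta> k m))"
proof (rule fps_ext)
  fix m
  define N where "N = int m + 2 * int k + 1"
  define C where "C = 2 * (-1) ^ k * r ^ m / (2 * sin \<theta>) ^ (2 * k + 1)"
  let ?S = "sine_sum \<theta> (int k + 1)"
  have 0: "response r \<theta> (Suc k) m = C * ?S N"
    by (simp add: response_def C_def N_def algebra_simps)
  have 1: "r * (if m = 0 then 0 else response r \<theta> (Suc k) (m - 1)) = C * ?S (N - 1)"
  proof (cases m)
    case 0
    then show ?thesis using sine_sum_boundary(1)[of "int k + 1" \<theta>] assms by (simp add: N_def algebra_simps)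
  next
    case (Suc i)
    then show ?thesis by (simp add: response_def C_def N_def algebra_simps)
  qed
  have 2: "r\<^sup>2 * (if m < 2 then 0 else response r \<theta> (Suc k) (m - 2)) = C * ?S (N - 2)"
  proof -
    consider "m = 0" | "m = 1" | i where "m = i + 2"
      by (metis One_nat_def add_2_eq_Suc' not0_implies_Suc)
    then show ?thesis
    proof cases
      case 3
      then show ?thesis by (simp add: response_def C_def N_def algebra_simps power2_eq_square)
    qed (use sine_sum_boundary[of "int k + 1" \<theta>] assms in \<open>simp_all add: N_def algebra_simps\<close>)
  qed
  have 3: "response r \<theta> k m = C * - (4 * (sin \<theta>)\<^sup>2 * sine_sum \<theta> (int k) (N - 2))"
  proof -
    obtain l where "k = Suc l" using assms(2) by (cases k) auto
    then show ?thesis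
      using assms(1) by (simp add: response_def C_def N_def field_simps power2_eq_square)
  qed
  have "response r \<theta> (Suc k) m - 2 * r * cos \<theta> * (if m = 0 then 0 else response r \<theta> (Suc k) (m - 1))
      + r\<^sup>2 * (if m < 2 then 0 else response r \<theta> (Suc k) (m - 2))
    = C * (?S N - 2 * cos \<theta> * ?S (N - 1) + ?S (N - 2))"
    unfolding 2 0 using 1 by (simp add: algebra_simps)
  also have "\<dots> = response r \<theta> k m"
    unfolding sine_sum_recurrence 3 by simp
  finally show "fps_nth (denom_fps r \<theta> * Abs_fps (\<lambda>m. of_real (response r \<theta> (Suc k) m))) m =
      fps_nth (Abs_fps (\<lambda>m. of_real (response r \<theta> k m))) m"
    unfolding denom_fps_mult_nth by simp
qed

lemma response_fps:
  assumes "sin \<theta> \<noteq> 0" and "k \<ge> 1"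
  shows "Abs_fps (\<lambda>m. of_real (response r \<theta> k m)) = inverse (denom_fps r \<theta> ^ k)"
proof -
  have "denom_fps r \<theta> ^ k * Abs_fps (\<lambda>m. of_real (response r \<theta> k m)) = 1"
    using assms(2)
  proof (induction k rule: dec_induct)
    case base
    show ?case using denom_fps_response_one[OF assms(1)] by simp
  next
    case (step k)
    then show ?case
      using denom_fps_response_Suc[OF assms(1), of k r]
      by (simp only: power_Suc2 mult.assoc)
  qed
  then show ?thesis using fps_inverse_unique by metis
qed

section \<open>The transform as a power series in the reciprocal variable\<close>

lemma has_ztransform_fps_nth:
  assumes "f has_fps_expansion F" and "\<forall>\<^sub>F z in at_infinity. X z = f (inverse z)"
  shows "has_ztransform (fps_nth F) X"
proof -
  have "\<forall>\<^sub>F w::complex in nhds 0. ereal (norm w) < fps_conv_radius F"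
  proof -
    have "open (eball (0::complex) (fps_conv_radius F))" "0 \<in> eball (0::complex) (fps_conv_radius F)"
      using assms(1) by (auto simp: has_fps_expansion_def zero_ereal_def)
    from eventually_nhds_in_open[OF this] show ?thesis by (simp add: eball_def)
  qed
  moreover have "\<forall>\<^sub>F w in nhds 0. eval_fps F w = f w"
    using assms(1) by (simp add: has_fps_expansion_def)
  ultimately have "\<forall>\<^sub>F w in nhds 0. (\<lambda>n. fps_nth F n * w ^ n) sums f w"
    by eventually_elim (metis sums_eval_fps)
  then have "\<forall>\<^sub>F z in at_infinity. (\<lambda>n. fps_nth F n * inverse z ^ n) sums f (inverse z)"
    using filterlim_iff tendsto_inverse_0 by blast
  with assms(2) show ?thesis
    unfolding has_ztransform_def
    by eventually_elim (simp add: power_int_minus power_inverse)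
qed

theorem corollary3p5:
  fixes k :: nat and a b A\<^sub>0 A\<^sub>1 r \<theta> :: real
    and g :: "nat \<Rightarrow> complex" and f\<^sub>0 f\<^sub>1 :: "nat \<Rightarrow> real"
  assumes "k \<ge> 1" and "b \<noteq> 0" and "r > 0"
    and "of_real a + \<i> * of_real b = of_real r * exp (\<i> * of_real \<theta>)"
    and "of_real a - \<i> * of_real b = of_real r * exp (- (\<i> * of_real \<theta>))"
    and "g = inv_ztransform (\<lambda>z. (of_real A\<^sub>1 * z + of_real A\<^sub>0) /
           (z\<^sup>2 - 2 * of_real a * z + of_real (a\<^sup>2 + b\<^sup>2)) ^ k)"
    and "\<And>n. f\<^sub>0 n = 2 * (-1) ^ (k - 1) * r powi (int n - 2 * int k) / (2 * sin \<theta>) ^ (2 * k - 1) *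
           (\<Sum>j = 0..k - 1. (-1) ^ j * binom (int n - 1) j *
              binom (int n - (int k + 1 + int j)) (k - 1 - j) *
              sin ((real n - 2 * real j - 1) * \<theta>))"
    and "\<And>n. f\<^sub>1 n = f\<^sub>0 (n + 1)"
  shows "\<forall>n. g n = of_real (A\<^sub>1 * f\<^sub>1 n + A\<^sub>0 * f\<^sub>0 n) \<and>
             g n = of_real (A\<^sub>1 * f\<^sub>0 (n + 1) + A\<^sub>0 * f\<^sub>0 n)"
proof -
  have polar: "of_real a + \<i> * of_real b = of_real r * cis \<theta>"
    using assms(4) by (simp add: cis_conv_exp)
  have a: "a = r * cos \<theta>" and b: "b = r * sin \<theta>"
    using arg_cong[OF polar, of Re] arg_cong[OF polar, of Im] by simp_all
  have sin: "sin \<theta> \<noteq> 0" using b assms(2) by auto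
  have r2: "a\<^sup>2 + b\<^sup>2 = r\<^sup>2"
    using sin_cos_squared_add[of \<theta>] unfolding a b power_mult_distrib
    by (metis add.commute distrib_left mult.right_neutral)
  have f0: "f\<^sub>0 n = (if n < 2 * k then 0 else response r \<theta> k (n - 2 * k))" for n
  proof (cases "n < 2 * k")
    case True
    then have "binom (int n - (int k + 1 + int j)) (k - 1 - j) = 0" if "j \<in> {0..k - 1}" for j
      using that assms(1) by (auto simp: binom_def of_nat_diff)
    then show ?thesis using True unfolding assms(7) by simp
  next
    case False
    have "(\<Sum>j = 0..k - 1. (-1) ^ j * binom (int n - 1) j *
              binom (int n - (int k + 1 + int j)) (k - 1 - j) *
              sin ((real n - 2 * real j - 1) * \<theta>)) = sine_sum \<theta> (int k) (int n - 1)"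
      unfolding sine_sum_def
    proof (rule sum.reindex_bij_witness[of _ nat int])
      fix j assume j: "j \<in> {0..k - 1}"
      \<comment> \<open>For \<open>n \<ge> 2k\<close> and \<open>j < k\<close> neither cut-off in \<^const>\<open>binom\<close> takes effect.\<close>
      have "binom (int n - 1) j = zbinom (int n - 1) (int j)"
        using j False assms(1) by (intro binom_eq_zbinom) auto
      moreover have "binom (int n - (int k + 1 + int j)) (k - 1 - j)
          = zbinom (int n - 1 - int k - int j) (int k - 1 - int j)"
        using j False assms(1) by (subst binom_eq_zbinom) (auto simp: of_nat_diff algebra_simps)
      ultimately show "coef (int k) (int n - 1) (int j) * sin (of_int (int n - 1 - 2 * int j) * \<theta>) =
          (-1) ^ j * binom (int n - 1) j * binom (int n - (int k + 1 + int j)) (k - 1 - j) *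
          sin ((real n - 2 * real j - 1) * \<theta>)"
        by (simp add: coef_def algebra_simps)
    qed (use assms(1) in auto)
    moreover have "r powi (int n - 2 * int k) = r ^ (n - 2 * k)"
      using False by (simp add: power_int_def nat_diff_distrib' nat_mult_distrib)
    ultimately show ?thesis
      using False unfolding assms(7) by (simp add: response_def of_nat_diff)
  qed
  define F where "F = inverse (denom_fps r \<theta> ^ k)"
  \<comment> \<open>The shift by \<open>2k\<close> accounts for the zeros of \<open>f\<^sub>0\<close> below \<open>2k\<close>, and the extra factor
    \<open>z = 1/w\<close> in front of \<open>A\<^sub>1\<close> for the advance by one.\<close>
  define G where "G = (fps_const (of_real A\<^sub>1) * fps_X ^ (2 * k - 1) + fps_const (of_real A\<^sub>0) * fps_X ^ (2 * k)) * F"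
  have nth_F: "fps_nth F m = of_real (response r \<theta> k m)" for m
    unfolding F_def response_fps[OF sin assms(1), symmetric] by simp
  have nth_G: "fps_nth G n = of_real (A\<^sub>1 * f\<^sub>0 (n + 1) + A\<^sub>0 * f\<^sub>0 n)" for n
    using assms(1) by (auto simp: G_def f0 nth_F distrib_right mult.assoc fps_X_power_mult_nth Suc_diff_le
        intro!: arg_cong[where f = "response r \<theta> k"])
  define f where "f w = (of_real A\<^sub>1 * w ^ (2 * k - 1) + of_real A\<^sub>0 * w ^ (2 * k)) *
      inverse ((1 - of_real (2 * r * cos \<theta>) * w + of_real (r\<^sup>2) * w\<^sup>2) ^ k)" for w :: complex
  have "f has_fps_expansion G"
    unfolding f_def G_def F_def denom_fps_def
    by (intro fps_expansion_intros) (simp add: fps_nth_power_0)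
  moreover have "\<forall>\<^sub>F z in at_infinity. (of_real A\<^sub>1 * z + of_real A\<^sub>0) /
      (z\<^sup>2 - 2 * of_real a * z + of_real (a\<^sup>2 + b\<^sup>2)) ^ k = f (inverse z)"
  proof -
    have "(of_real A\<^sub>1 * z + of_real A\<^sub>0) / (z\<^sup>2 - 2 * of_real a * z + of_real (a\<^sup>2 + b\<^sup>2)) ^ k = f (inverse z)"
      if z: "z \<noteq> 0" for z :: complex
    proof -
      define D where "D = z\<^sup>2 - 2 * of_real a * z + of_real (r\<^sup>2)"
      have "1 - of_real (2 * r * cos \<theta>) * inverse z + of_real (r\<^sup>2) * (inverse z)\<^sup>2 = D / z\<^sup>2"
        using z by (simp add: D_def a field_simps power2_eq_square)
      then have "inverse ((1 - of_real (2 * r * cos \<theta>) * inverse z + of_real (r\<^sup>2) * (inverse z)\<^sup>2) ^ k)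
          = z ^ (2 * k) / D ^ k"
        by (simp add: power_divide power_mult)
      moreover have "(of_real A\<^sub>1 * inverse z ^ (2 * k - 1) + of_real A\<^sub>0 * inverse z ^ (2 * k)) * z ^ (2 * k)
          = of_real A\<^sub>1 * z + of_real A\<^sub>0"
      proof -
        have "z ^ (2 * k) = z ^ (2 * k - 1) * z"
          using assms(1) by (metis One_nat_def Suc_le_eq mult_pos_pos pos2 power_minus_mult)
        then have "inverse z ^ (2 * k - 1) * z ^ (2 * k) = z"
          using z by (simp add: power_inverse)
        moreover have "inverse z ^ (2 * k) * z ^ (2 * k) = 1"
          using z by (simp flip: power_mult_distrib)
        ultimately show ?thesis by (simp add: distrib_right mult.assoc)
      qed
      ultimately show ?thesis
        unfolding f_def r2 D_def[symmetric] by (metis times_divide_eq_right)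
    qed
    moreover have "\<forall>\<^sub>F z::complex in at_infinity. z \<noteq> 0"
      by (rule eventually_not_equal_at_infinity)
    ultimately show ?thesis by (auto elim: eventually_mono)
  qed
  ultimately have "g = fps_nth G"
    unfolding assms(6) by (intro inv_ztransform_eqI has_ztransform_fps_nth)
  then show ?thesis by (simp add: nth_G assms(8))
qed

end
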